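(* Let $\mathbb{F}_q$ be a finite field of characteristic different from $2$ with $q \equiv 1 \pmod 3$. Then there is a one-to-one correspondence, given by taking the quadratic twist, between $\mathbb{F}_q$-isomorphism classes of elliptic curves over $\mathbb{F}_q$ having an $\mathbb{F}_q$-rational point of order $3$ and $\mathbb{F}_q$-isomorphism classes of elliptic curves over $\mathbb{F}_q$ having a rational subgroup of order $3$ whose nonzero points are not defined over $\mathbb{F}_q$.
   Context: A subgroup $G\subset E(\overline{\mathbb{F}}_q)$ is called rational (over $\mathbb{F}_q$) if it is stable, as a set, under the $q$-power Frobenius map $(x,y)\mapsto(x^q,y^q)$; its individual points need not be defined over $\mathbb{F}_q$. The quadratic twist (twisted curve) of $y^2=x^3+Ax+B$ over $\mathbb{F}_q$ is $y^2=x^3+t^2Ax+t^3B$, where $t\in\mathbb{F}_q^*$ is a fixed non-square. *)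

theory Defs
  imports "HOL-Algebra.Algebraic_Closure_Type" "HOL-Library.Cardinality"
begin

section \<open>Weierstrass curves\<close>

text \<open>
  \<open>WCurve a1 a2 a3 a4 a6\<close> stands for
  \<open>y\<^sup>2 + a1 x y + a3 y = x\<^sup>3 + a2 x\<^sup>2 + a4 x + a6\<close>.
  The generated map function \<open>map_wcurve to_ac\<close> is base change to the algebraic closure.
\<close>

datatype 'k wcurve =
  WCurve (coeff1: 'k) (coeff2: 'k) (coeff3: 'k) (coeff4: 'k) (coeff6: 'k)

definition short_curve :: "'k::field \<Rightarrow> 'k \<Rightarrow> 'k wcurve" where
  "short_curve A B = WCurve 0 0 0 A B"

definition wpoly :: "'k::field wcurve \<Rightarrow> 'k \<Rightarrow> 'k \<Rightarrow> 'k" where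
  "wpoly E x y = y^2 + coeff1 E * x * y + coeff3 E * y
     - (x^3 + coeff2 E * x^2 + coeff4 E * x + coeff6 E)"

definition wpoly_dx :: "'k::field wcurve \<Rightarrow> 'k \<Rightarrow> 'k \<Rightarrow> 'k" where
  "wpoly_dx E x y = coeff1 E * y - (3 * x^2 + 2 * coeff2 E * x + coeff4 E)"

definition wpoly_dy :: "'k::field wcurve \<Rightarrow> 'k \<Rightarrow> 'k \<Rightarrow> 'k" where
  "wpoly_dy E x y = 2 * y + coeff1 E * x + coeff3 E"

text \<open>
  An elliptic curve over a field is a Weierstrass curve that is smooth over the algebraic
  closure; the point at infinity of a Weierstrass curve is always smooth.
\<close>

definition elliptic :: "'a::field wcurve \<Rightarrow> bool" where
  "elliptic E \<longleftrightarrow> (\<forall>x y :: 'a alg_closure.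
     \<not> (wpoly (map_wcurve to_ac E) x y = 0 \<and>
        wpoly_dx (map_wcurve to_ac E) x y = 0 \<and>
        wpoly_dy (map_wcurve to_ac E) x y = 0))"

section \<open>Points and the group law\<close>

datatype 'k point = Infinity | Affine 'k 'k

fun on_curve :: "'k::field wcurve \<Rightarrow> 'k point \<Rightarrow> bool" where
  "on_curve E Infinity \<longleftrightarrow> True"
| "on_curve E (Affine x y) \<longleftrightarrow> wpoly E x y = 0"

text \<open>
  Chord and tangent addition, in any characteristic. The negative of \<open>(x, y)\<close> is
  \<open>(x, - y - a1 x - a3)\<close>; for points of the curve the tangent slope is used only
  when the two summands coincide and the denominator is nonzero.
\<close>

fun point_add :: "'k::field wcurve \<Rightarrow> 'k point \<Rightarrow> 'k point \<Rightarrow> 'k point" where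
  "point_add E Infinity Q = Q"
| "point_add E (Affine x1 y1) Infinity = Affine x1 y1"
| "point_add E (Affine x1 y1) (Affine x2 y2) =
     (if x1 = x2 \<and> y1 + y2 + coeff1 E * x1 + coeff3 E = 0 then Infinity
      else
        let l = (if x1 = x2 then - wpoly_dx E x1 y1 / wpoly_dy E x1 y1
                 else (y2 - y1) / (x2 - x1));
            x3 = l^2 + coeff1 E * l - coeff2 E - x1 - x2
        in Affine x3 (- (y1 + l * (x3 - x1)) - coeff1 E * x3 - coeff3 E))"

text \<open>The group of points over the algebraic closure, written multiplicatively.\<close>

definition ec_group :: "'a::field wcurve \<Rightarrow> 'a alg_closure point monoid" where
  "ec_group E = \<lparr> carrier = {P. on_curve (map_wcurve to_ac E) P},
                   monoid.mult = point_add (map_wcurve to_ac E),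
                   one = Infinity \<rparr>"

text \<open>
  Order of an element as the least positive exponent. The constant \<open>group.ord\<close> is avoided
  because its value is only meaningful once associativity has been established.
\<close>

definition has_order :: "('g, 'm) monoid_scheme \<Rightarrow> 'g \<Rightarrow> nat \<Rightarrow> bool" where
  "has_order G x n \<longleftrightarrow> x \<in> carrier G \<and> 0 < n \<and> x [^]\<^bsub>G\<^esub> n = \<one>\<^bsub>G\<^esub> \<and>
     (\<forall>k::nat. 0 < k \<and> k < n \<longrightarrow> x [^]\<^bsub>G\<^esub> k \<noteq> \<one>\<^bsub>G\<^esub>)"

fun rational_point :: "'a::field alg_closure point \<Rightarrow> bool" where
  "rational_point Infinity \<longleftrightarrow> True"
| "rational_point (Affine x y) \<longleftrightarrow> x \<in> range to_ac \<and> y \<in> range to_ac"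

definition frobenius_point ::
    "'a::{field,finite} alg_closure point \<Rightarrow> 'a alg_closure point" where
  "frobenius_point = map_point (\<lambda>x. x ^ CARD('a))"

definition rational_subgroup ::
    "'a::{field,finite} wcurve \<Rightarrow> 'a alg_closure point set \<Rightarrow> bool" where
  "rational_subgroup E G \<longleftrightarrow> subgroup G (ec_group E) \<and> frobenius_point ` G = G"

definition has_rational_point_of_order :: "'a::field wcurve \<Rightarrow> nat \<Rightarrow> bool" where
  "has_rational_point_of_order E n \<longleftrightarrow>
     (\<exists>P. has_order (ec_group E) P n \<and> rational_point P)"

definition has_rational_subgroup_without_rational_points ::
    "'a::{field,finite} wcurve \<Rightarrow> nat \<Rightarrow> bool" where
  "has_rational_subgroup_without_rational_points E n \<longleftrightarrow>
     (\<exists>G. rational_subgroup E G \<and> card G = n \<and>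
          (\<forall>P\<in>G. P \<noteq> Infinity \<longrightarrow> \<not> rational_point P))"

section \<open>Isomorphism over the base field\<close>

text \<open>
  Isomorphisms over \<open>K\<close> are the admissible changes of variables
  \<open>(x, y) \<mapsto> (u\<^sup>2 x + r, u\<^sup>3 y + u\<^sup>2 s x + t)\<close> with \<open>u, r, s, t\<close> in \<open>K\<close> and \<open>u \<noteq> 0\<close>
  that turn the equation of \<open>E\<close> into that of \<open>E'\<close>, up to the factor \<open>u\<^sup>6\<close>. As the algebraic
  closure is infinite, quantifying over its elements amounts to an identity of polynomials;
  over a finite \<open>K\<close> itself it would not.
\<close>

definition isomorphic_over_base :: "'a::field wcurve \<Rightarrow> 'a wcurve \<Rightarrow> bool" where
  "isomorphic_over_base E E' \<longleftrightarrow>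
     (\<exists>u r s t :: 'a. u \<noteq> 0 \<and>
       (\<forall>x y :: 'a alg_closure.
          wpoly (map_wcurve to_ac E)
            (to_ac u ^ 2 * x + to_ac r)
            (to_ac u ^ 3 * y + to_ac u ^ 2 * to_ac s * x + to_ac t)
          = to_ac u ^ 6 * wpoly (map_wcurve to_ac E') x y))"

definition ec_iso :: "('a::field wcurve \<times> 'a wcurve) set" where
  "ec_iso = {(E, E'). elliptic E \<and> elliptic E' \<and> isomorphic_over_base E E'}"

lemma isomorphic_over_base_refl: "isomorphic_over_base E E"
  unfolding isomorphic_over_base_def
  by (rule exI[of _ 1], rule exI[of _ 0], rule exI[of _ 0], rule exI[of _ 0]) simp

lemma isomorphic_over_base_sym:
  assumes "isomorphic_over_base E (E' :: 'a::field wcurve)"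
  shows "isomorphic_over_base E' E"
proof -
  obtain u r s t :: 'a where u: "u \<noteq> 0" and eq:
    "\<And>x y. wpoly (map_wcurve to_ac E)
            (to_ac u ^ 2 * x + to_ac r)
            (to_ac u ^ 3 * y + to_ac u ^ 2 * to_ac s * x + to_ac t)
          = to_ac u ^ 6 * wpoly (map_wcurve to_ac E') x y"
    using assms unfolding isomorphic_over_base_def by blast
  define u' where "u' = inverse u"
  define r' where "r' = - r * u'^2"
  define s' where "s' = - s * u'"
  define t' where "t' = (s * r - t) * u'^3"
  have "wpoly (map_wcurve to_ac E')
            (to_ac u' ^ 2 * x + to_ac r')
            (to_ac u' ^ 3 * y + to_ac u' ^ 2 * to_ac s' * x + to_ac t')
          = to_ac u' ^ 6 * wpoly (map_wcurve to_ac E) x y" for x y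
  proof -
    let ?x = "to_ac u' ^ 2 * x + to_ac r'"
    let ?y = "to_ac u' ^ 3 * y + to_ac u' ^ 2 * to_ac s' * x + to_ac t'"
    have uu: "to_ac u * to_ac u' = 1"
      using u by (simp add: u'_def)
    have pow: "to_ac u ^ n * to_ac u' ^ n = 1" for n
      using uu by (simp flip: power_mult_distrib)
    have "to_ac u ^ 2 * ?x + to_ac r = to_ac u ^ 2 * to_ac u' ^ 2 * (x - to_ac r) + to_ac r"
      unfolding r'_def by (simp add: algebra_simps)
    then have x: "to_ac u ^ 2 * ?x + to_ac r = x"
      unfolding pow by simp
    have "to_ac u ^ 3 * ?y + to_ac u ^ 2 * to_ac s * ?x + to_ac t
        = to_ac u ^ 3 * to_ac u' ^ 3 * (y - to_ac s * x + to_ac s * to_ac r - to_ac t)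
          + to_ac u ^ 2 * to_ac u' ^ 2 * to_ac s * (x - to_ac r) + to_ac t"
      unfolding r'_def s'_def t'_def
      by (simp add: algebra_simps power2_eq_square power3_eq_cube)
    then have y: "to_ac u ^ 3 * ?y + to_ac u ^ 2 * to_ac s * ?x + to_ac t = y"
      unfolding pow by (simp add: algebra_simps)
    have "wpoly (map_wcurve to_ac E') ?x ?y
        = to_ac u ^ 6 * to_ac u' ^ 6 * wpoly (map_wcurve to_ac E') ?x ?y"
      unfolding pow by simp
    also have "\<dots> = to_ac u' ^ 6 * wpoly (map_wcurve to_ac E) x y"
      using eq[of ?x ?y] unfolding x y by (simp add: mult_ac)
    finally show ?thesis .
  qed
  moreover have "u' \<noteq> 0"
    using u by (simp add: u'_def)
  ultimately show ?thesis
    unfolding isomorphic_over_base_def by blast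
qed

lemma isomorphic_over_base_trans:
  assumes "isomorphic_over_base E (E' :: 'a::field wcurve)" "isomorphic_over_base E' E''"
  shows "isomorphic_over_base E E''"
proof -
  obtain u r s t :: 'a where u: "u \<noteq> 0" and eq:
    "\<And>x y. wpoly (map_wcurve to_ac E)
            (to_ac u ^ 2 * x + to_ac r)
            (to_ac u ^ 3 * y + to_ac u ^ 2 * to_ac s * x + to_ac t)
          = to_ac u ^ 6 * wpoly (map_wcurve to_ac E') x y"
    using assms(1) unfolding isomorphic_over_base_def by blast
  obtain u' r' s' t' :: 'a where u': "u' \<noteq> 0" and eq':
    "\<And>x y. wpoly (map_wcurve to_ac E')
            (to_ac u' ^ 2 * x + to_ac r')
            (to_ac u' ^ 3 * y + to_ac u' ^ 2 * to_ac s' * x + to_ac t')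
          = to_ac u' ^ 6 * wpoly (map_wcurve to_ac E'') x y"
    using assms(2) unfolding isomorphic_over_base_def by blast
  define v where "v = u * u'"
  define r2 where "r2 = u^2 * r' + r"
  define s2 where "s2 = u * s' + s"
  define t2 where "t2 = u^3 * t' + u^2 * s * r' + t"
  have "wpoly (map_wcurve to_ac E)
            (to_ac v ^ 2 * x + to_ac r2)
            (to_ac v ^ 3 * y + to_ac v ^ 2 * to_ac s2 * x + to_ac t2)
          = to_ac v ^ 6 * wpoly (map_wcurve to_ac E'') x y" for x y
  proof -
    let ?x = "to_ac u' ^ 2 * x + to_ac r'"
    let ?y = "to_ac u' ^ 3 * y + to_ac u' ^ 2 * to_ac s' * x + to_ac t'"
    have x: "to_ac u ^ 2 * ?x + to_ac r = to_ac v ^ 2 * x + to_ac r2"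
      by (simp add: v_def r2_def algebra_simps power_mult_distrib)
    have y: "to_ac u ^ 3 * ?y + to_ac u ^ 2 * to_ac s * ?x + to_ac t
        = to_ac v ^ 3 * y + to_ac v ^ 2 * to_ac s2 * x + to_ac t2"
      by (simp add: v_def s2_def t2_def algebra_simps power2_eq_square power3_eq_cube)
    show ?thesis
      using eq[of ?x ?y] unfolding x y eq' by (simp add: v_def power_mult_distrib mult.assoc)
  qed
  moreover have "v \<noteq> 0"
    using u u' by (simp add: v_def)
  ultimately show ?thesis
    unfolding isomorphic_over_base_def by blast
qed

lemma equiv_ec_iso: "equiv {E. elliptic E} ec_iso"
proof (rule equivI)
  show "ec_iso \<subseteq> {E. elliptic E} \<times> {E. elliptic E}"
    by (auto simp: ec_iso_def)
  show "refl_on {E. elliptic E} ec_iso"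
    by (auto simp: refl_on_def ec_iso_def isomorphic_over_base_refl)
  show "sym ec_iso"
    by (auto simp: sym_def ec_iso_def intro: isomorphic_over_base_sym)
  show "trans ec_iso"
    by (auto simp: trans_def ec_iso_def intro: isomorphic_over_base_trans)
qed

section \<open>Quadratic twists\<close>

definition quadratic_twist :: "'k::field \<Rightarrow> 'k \<Rightarrow> 'k \<Rightarrow> 'k wcurve" where
  "quadratic_twist t A B = short_curve (t^2 * A) (t^3 * B)"

text \<open>
  The twist of an isomorphism class: all curves isomorphic to the twist of some short
  Weierstrass equation in the class. The result is a single isomorphism class only if
  there is such an equation and the twist does not depend, up to isomorphism, on its choice.
\<close>

definition twist_class :: "'a::field \<Rightarrow> 'a wcurve set \<Rightarrow> 'a wcurve set" where
  "twist_class t C = ec_iso `` {quadratic_twist t A B | A B. short_curve A B \<in> C}"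

end

(*
  Over a field of characteristic other than 2 and 3 every elliptic curve has a short equation
  y^2 = f(x), and a nonzero point (x, y) has order three iff x is a root of the third division
  polynomial and y is nonzero. A subgroup of order three is {O, P, -P}, so it is stable under
  Frobenius iff the abscissa x of P is rational. Hence a rational point of order three amounts to
  a rational root x with f(x) a nonzero square, and a rational subgroup of order three without
  rational points to a rational root with f(x) a nonsquare. Twisting by t moves x to t x and
  multiplies f(x) by t^3, which swaps the two cases because the squares have index two in the
  multiplicative group. Twisting twice by t gives back the curve up to isomorphism.
*)

theory Submission
  imports Defs
begin

section \<open>Points of order three\<close>

text \<open>
  The equation is \<open>x(2P) = x(P)\<close>, that is \<open>2P = - P\<close>, with the denominator of the tangent slope cleared.
\<close>

definition flex :: "'k::field wcurve \<Rightarrow> 'k \<Rightarrow> 'k \<Rightarrow> bool" where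
  "flex E x y \<longleftrightarrow> wpoly E x y = 0 \<and> wpoly_dy E x y \<noteq> 0 \<and>
     wpoly_dx E x y ^ 2 - coeff1 E * wpoly_dx E x y * wpoly_dy E x y
       = (3 * x + coeff2 E) * wpoly_dy E x y ^ 2"

definition point_neg :: "'k::field wcurve \<Rightarrow> 'k point \<Rightarrow> 'k point" where
  "point_neg E P = (case P of Infinity \<Rightarrow> Infinity
     | Affine x y \<Rightarrow> Affine x (- y - coeff1 E * x - coeff3 E))"

lemma point_neg_simps [simp]:
  "point_neg E Infinity = Infinity"
  "point_neg E (Affine x y) = Affine x (- y - coeff1 E * x - coeff3 E)"
  by (simp_all add: point_neg_def)

lemma point_add_Infinity_right [simp]: "point_add E P Infinity = P"
  by (cases P) auto

text \<open>The branch of \<open>point_add\<close> returning \<open>Infinity\<close> for two affine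
  points tests literally for the negative, so the equivalence is formal and involves no group
  axioms.\<close>

lemma point_add_eq_Infinity_iff: "point_add E P Q = Infinity \<longleftrightarrow> Q = point_neg E P"
proof (cases P)
  case P: (Affine x y)
  show ?thesis
  proof (cases Q)
    case (Affine x' y')
    then show ?thesis
      using P by (auto simp: Let_def algebra_simps eq_neg_iff_add_eq_0)
  qed (use P in auto)
qed auto

lemma point_neg_neg [simp]: "point_neg E (point_neg E P) = P"
  by (cases P) (auto simp: algebra_simps)

lemma on_curve_neg [simp]: "on_curve E (point_neg E P) \<longleftrightarrow> on_curve E P"
  by (cases P) (auto simp: wpoly_def algebra_simps power2_eq_square)

lemma wpoly_dy_neg: "wpoly_dy E x (- y - coeff1 E * x - coeff3 E) = - wpoly_dy E x y"
  by (simp add: wpoly_dy_def)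

lemma point_add_self:
  assumes "wpoly_dy E x y \<noteq> 0"
  shows "point_add E (Affine x y) (Affine x y) =
     (let l = - wpoly_dx E x y / wpoly_dy E x y; x3 = l^2 + coeff1 E * l - coeff2 E - x - x
      in Affine x3 (- (y + l * (x3 - x)) - coeff1 E * x3 - coeff3 E))"
  using assms by (simp add: Let_def wpoly_dy_def)

lemma flex_iff:
  assumes "wpoly E x y = 0" "wpoly_dy E x y \<noteq> 0"
  defines "l \<equiv> - wpoly_dx E x y / wpoly_dy E x y"
  shows "flex E x y \<longleftrightarrow> l^2 + coeff1 E * l - coeff2 E - x - x = x"
proof -
  have "l * wpoly_dy E x y = - wpoly_dx E x y"
    using assms by simp
  then have "wpoly_dx E x y = - (l * wpoly_dy E x y)" by simp
  then have "flex E x y \<longleftrightarrow>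
      (l^2 + coeff1 E * l) * wpoly_dy E x y ^ 2 = (3 * x + coeff2 E) * wpoly_dy E x y ^ 2"
    using assms(1,2) by (simp add: flex_def algebra_simps power2_eq_square)
  also have "\<dots> \<longleftrightarrow> l^2 + coeff1 E * l = 3 * x + coeff2 E"
    using assms(2) by simp
  also have "\<dots> \<longleftrightarrow> l^2 + coeff1 E * l - coeff2 E - x - x = x"
    by (auto simp: algebra_simps)
  finally show ?thesis .
qed

text \<open>Once the double has abscissa \<open>x\<close>, the addition formula gives it the
  ordinate of the negative, so comparing abscissas is enough.\<close>

lemma flex_iff_double_eq_neg:
  assumes "wpoly E x y = 0" "wpoly_dy E x y \<noteq> 0"
  shows "flex E x y \<longleftrightarrow> point_add E (Affine x y) (Affine x y) = point_neg E (Affine x y)"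
  unfolding flex_iff[OF assms] point_add_self[OF assms(2)] by (auto simp: Let_def)

text \<open>Serves where the double is only known to lie over the same abscissa. Being affine, it
  excludes a vertical tangent, and the addition formula then leaves only the negative.\<close>

lemma double_eq_negI:
  assumes "wpoly E x y = 0" "point_add E (Affine x y) (Affine x y) = Affine x y'"
  shows "flex E x y \<and> y' = - y - coeff1 E * x - coeff3 E"
proof -
  have dy: "wpoly_dy E x y \<noteq> 0"
    using assms(2) by (auto simp: wpoly_dy_def)
  then show ?thesis
    using assms(2) unfolding flex_iff[OF assms(1) dy] point_add_self[OF dy]
    by (auto simp: Let_def)
qed

lemma flex_neg:
  assumes "flex E x y"
  shows "flex E x (- y - coeff1 E * x - coeff3 E)"
proof -
  have "wpoly E x (- y - coeff1 E * x - coeff3 E) = wpoly E x y"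
    by (simp add: wpoly_def algebra_simps power2_eq_square)
  moreover have dx: "wpoly_dx E x (- y - coeff1 E * x - coeff3 E)
      = wpoly_dx E x y - coeff1 E * wpoly_dy E x y"
    by (simp add: wpoly_dx_def wpoly_dy_def algebra_simps)
  ultimately show ?thesis
    using assms unfolding flex_def wpoly_dy_neg dx
    by (simp add: algebra_simps power2_eq_square)
qed

text \<open>
  If a chord through two points meets the curve a second time in one of them, it is tangent
  there; at a two-torsion point the tangent is vertical, unless the point is singular.
\<close>

lemma tangent_chord_singular:
  assumes P: "wpoly E x y = 0" and Q: "wpoly E x' y' = 0"
    and dy: "wpoly_dy E x y = 0" and ne: "x \<noteq> x'"
    and l: "l * (x' - x) = y' - y" "l^2 + coeff1 E * l - coeff2 E = 2 * x + x'"
  shows "wpoly_dx E x y = 0"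
proof -
  define h where "h = x' - x"
  have x': "x' = x + h" and y': "y' = y + l * h"
    using l by (simp_all add: h_def)
  \<comment> \<open>Taylor expansion along the chord at \<open>(x, y)\<close>: the terms of order
    two and three in \<open>h\<close> combine to a multiple of the second equation in
    \<open>l\<close>, which makes them vanish.\<close>
  have "wpoly E x' y' = wpoly E x y + wpoly_dx E x y * h + wpoly_dy E x y * (l * h)
      + h^2 * (l^2 + coeff1 E * l - coeff2 E - (2 * x + x'))"
    unfolding x' y' wpoly_def wpoly_dx_def wpoly_dy_def
    by (simp add: algebra_simps power2_eq_square power3_eq_cube)
  then have "wpoly_dx E x y * h = 0"
    using P Q dy l(2) by simp
  then show ?thesis
    using ne by (simp add: h_def)
qed

section \<open>The group of points\<close>

abbreviation ac_curve :: "'a::field wcurve \<Rightarrow> 'a alg_closure wcurve" where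
  "ac_curve \<equiv> map_wcurve to_ac"

lemma ec_group_simps [simp]:
  "carrier (ec_group E) = {P. on_curve (ac_curve E) P}"
  "x \<otimes>\<^bsub>ec_group E\<^esub> y = point_add (ac_curve E) x y"
  "\<one>\<^bsub>ec_group E\<^esub> = Infinity"
  by (simp_all add: ec_group_def)

text \<open>\<open>m_inv\<close> is a definite description in a bare monoid; the criterion for a sum
  to be \<open>Infinity\<close> makes its witness unique without appeal to associativity.\<close>

lemma ec_group_inv:
  assumes "on_curve (ac_curve E) P"
  shows "inv\<^bsub>ec_group E\<^esub> P = point_neg (ac_curve E) P"
  unfolding m_inv_def using assms
  by (auto simp: point_add_eq_Infinity_iff intro!: the_equality)

text \<open>Order three means that \<open>P\<close> and \<open>2P\<close> are nonzero and
  \<open>3P = 0\<close>, that is, \<open>2P = -P\<close> and \<open>P\<close> differs from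
  \<open>-P\<close>. The second condition is the nonvanishing of \<open>wpoly_dy\<close>.\<close>

lemma has_order_three_iff:
  "has_order (ec_group E) P 3 \<longleftrightarrow> (\<exists>x y. P = Affine x y \<and> flex (ac_curve E) x y)"
proof -
  let ?E = "ac_curve E"
  have "has_order (ec_group E) P 3 \<longleftrightarrow> on_curve ?E P \<and> P \<noteq> Infinity \<and>
     point_add ?E P P \<noteq> Infinity \<and> point_add ?E (point_add ?E P P) P = Infinity"
  proof -
    have k: "(\<forall>k::nat. 0 < k \<and> k < 3 \<longrightarrow> R k) \<longleftrightarrow> R 1 \<and> R 2" for R
      by (auto simp: less_Suc_eq numeral_3_eq_3 numeral_2_eq_2)
    show ?thesis
      unfolding has_order_def k by (auto simp: nat_pow_def numeral_3_eq_3 numeral_2_eq_2)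
  qed
  also have "\<dots> \<longleftrightarrow> on_curve ?E P \<and> P \<noteq> Infinity \<and>
     P \<noteq> point_neg ?E P \<and> point_add ?E P P = point_neg ?E P"
    unfolding point_add_eq_Infinity_iff by (metis point_neg_neg)
  also have "\<dots> \<longleftrightarrow> (\<exists>x y. P = Affine x y \<and> flex ?E x y)"
  proof (cases P)
    case (Affine x y)
    have "y \<noteq> - y - coeff1 ?E * x - coeff3 ?E \<longleftrightarrow> wpoly_dy ?E x y \<noteq> 0"
      by (auto simp: wpoly_dy_def algebra_simps eq_neg_iff_add_eq_0)
    then show ?thesis
      using Affine flex_iff_double_eq_neg[of ?E x y] by (auto simp: flex_def)
  qed auto
  finally show ?thesis .
qed

text \<open>Associativity is not established, so Lagrange's theorem cannot be quoted. Instead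
  closure is examined by hand: two nonzero points that are their own negatives would force a
  singular point, so the nonzero points are \<open>P\<close> and \<open>-P\<close>.\<close>

lemma flex_of_subgroup_of_order_three:
  assumes ell: "elliptic E" and two: "(2::'a::field) \<noteq> 0"
    and sub: "subgroup G (ec_group (E :: 'a wcurve))" and card: "card G = 3"
  obtains x y where "flex (ac_curve E) x y"
    "G = {Infinity, Affine x y, point_neg (ac_curve E) (Affine x y)}"
proof -
  let ?E = "ac_curve E"
  interpret subgroup G "ec_group E" by fact
  have Inf: "Infinity \<in> G"
    using one_closed by simp
  have fin: "finite G"
    using card card.infinite by fastforce
  then have "card (G - {Infinity}) = 2"
    using card Inf by simp
  then obtain P Q where PQ: "G - {Infinity} = {P, Q}" "P \<noteq> Q"
    by (auto simp: card_2_iff)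
  then have G: "G = {Infinity, P, Q}" and "P \<noteq> Infinity" "Q \<noteq> Infinity"
    using Inf by auto
  then obtain x y x' y' where P: "P = Affine x y" and Q: "Q = Affine x' y'"
    by (meson point.exhaust)
  have on: "wpoly ?E x y = 0" "wpoly ?E x' y' = 0"
    using subset G P Q by auto
  have neg: "point_neg ?E R \<in> G" if "R \<in> G" for R
  proof -
    have "on_curve ?E R"
      using that subset by auto
    then show ?thesis
      using m_inv_closed[OF that] by (metis ec_group_inv)
  qed
  have add: "point_add ?E R S \<in> G" if "R \<in> G" "S \<in> G" for R S
    using m_closed[OF that] by simp
  have two': "(2 :: 'a alg_closure) \<noteq> 0"
    using two to_ac_eq_0_iff[of "2 :: 'a"] by simp
  have "point_neg ?E P \<noteq> P"
  proof
    assume nP: "point_neg ?E P = P"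
    have nQ: "point_neg ?E Q = Q"
      using neg[of Q] G Q nP \<open>P \<noteq> Q\<close> point_neg_neg[of ?E Q] by auto
    have dy: "wpoly_dy ?E x y = 0" "wpoly_dy ?E x' y' = 0"
      using nP nQ P Q by (auto simp: wpoly_dy_def algebra_simps)
    have ne: "x \<noteq> x'"
    proof
      assume "x = x'"
      then have "2 * y - 2 * y' = wpoly_dy ?E x y - wpoly_dy ?E x' y'"
        by (simp add: wpoly_dy_def)
      then have "2 * y = 2 * y'"
        using dy by simp
      then show False
        using \<open>x = x'\<close> two' \<open>P \<noteq> Q\<close> P Q by simp
    qed
    define l where "l = (y' - y) / (x' - x)"
    have l: "l * (x' - x) = y' - y" "l * (x - x') = y - y'"
      using ne by (simp_all add: l_def field_simps)
    \<comment> \<open>The sum is not \<open>Infinity\<close>, since \<open>Q\<close> differs from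
      \<open>P = -P\<close>. Hence the chord meets the curve doubly in \<open>P\<close> or in
      \<open>Q\<close>, where the tangent is also vertical.\<close>
    have "point_add ?E P Q \<in> {P, Q}"
      using add[of P Q] G nP \<open>P \<noteq> Q\<close> by (auto simp: point_add_eq_Infinity_iff)
    then have "l^2 + coeff1 ?E * l - coeff2 ?E - x - x' \<in> {x, x'}"
      using ne by (auto simp: P Q Let_def l_def)
    then consider "l^2 + coeff1 ?E * l - coeff2 ?E = 2 * x + x'"
      | "l^2 + coeff1 ?E * l - coeff2 ?E = 2 * x' + x"
      by (auto simp: algebra_simps)
    then have "wpoly_dx ?E x y = 0 \<or> wpoly_dx ?E x' y' = 0"
    proof cases
      case 1
      then show ?thesis
        using tangent_chord_singular[OF on dy(1) ne l(1)] by simp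
    next
      case 2
      then show ?thesis
        using tangent_chord_singular[OF on(2,1) dy(2) ne[symmetric] l(2)] by simp
    qed
    then show False
      using ell on dy unfolding elliptic_def by blast
  qed
  then have nP: "point_neg ?E P = Q"
    using neg[of P] G P by auto
  then have x': "x' = x" and y': "y' = - y - coeff1 ?E * x - coeff3 ?E"
    using P Q by auto
  have "point_add ?E P P \<noteq> Infinity"
    using \<open>point_neg ?E P \<noteq> P\<close> by (auto simp: point_add_eq_Infinity_iff)
  \<comment> \<open>Both remaining candidates for the double lie over \<open>x\<close>.\<close>
  then have "point_add ?E P P = Affine x y \<or> point_add ?E P P = Affine x y'"
    using add[of P P] G P Q x' by auto
  then have "flex ?E x y"
    using double_eq_negI[OF on(1)] P by blast
  then show ?thesis
    using that[of x y] G nP P by simp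
qed

text \<open>The relations \<open>P + P = -P\<close> and \<open>(-P) + (-P) = P\<close> complete the
  addition table; the second holds because \<open>flex\<close> passes to the negative.\<close>

lemma subgroup_of_flex:
  assumes "flex (ac_curve E) x y"
  shows "subgroup {Infinity, Affine x y, point_neg (ac_curve E) (Affine x y)} (ec_group E)"
    and "card {Infinity, Affine x y, point_neg (ac_curve E) (Affine x y)} = 3"
proof -
  let ?E = "ac_curve E"
  define P where "P = Affine x y"
  define N where "N = point_neg ?E P"
  have on: "on_curve ?E P" and dy: "wpoly_dy ?E x y \<noteq> 0"
    using assms by (auto simp: flex_def P_def)
  then have onN: "on_curve ?E N" by (simp add: N_def)
  have ne: "P \<noteq> N"
    using dy by (auto simp: P_def N_def wpoly_dy_def algebra_simps)
  have PP: "point_add ?E P P = N"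
    using assms flex_iff_double_eq_neg[of ?E x y] by (simp add: flex_def P_def N_def)
  have NN: "point_add ?E N N = P"
    using flex_neg[OF assms] flex_iff_double_eq_neg[of ?E x "- y - coeff1 ?E * x - coeff3 ?E"]
    by (simp add: flex_def P_def N_def)
  have PN: "point_add ?E P N = Infinity" "point_add ?E N P = Infinity"
    by (simp_all add: point_add_eq_Infinity_iff N_def)
  have inv: "inv\<^bsub>ec_group E\<^esub> P = N" "inv\<^bsub>ec_group E\<^esub> N = P"
    "inv\<^bsub>ec_group E\<^esub> Infinity = Infinity"
    using on onN by (simp_all add: ec_group_inv) (simp_all add: N_def)
  have "subgroup {Infinity, P, N} (ec_group E)"
    using on onN PP NN PN inv by unfold_locales auto
  then show "subgroup {Infinity, Affine x y, point_neg ?E (Affine x y)} (ec_group E)"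
    by (simp add: P_def N_def)
  show "card {Infinity, Affine x y, point_neg ?E (Affine x y)} = 3"
    using ne by (simp add: P_def N_def)
qed


section \<open>Changes of variables\<close>

lemma ac_curve_coeffs [simp]:
  "coeff1 (ac_curve E) = to_ac (coeff1 E)" "coeff2 (ac_curve E) = to_ac (coeff2 E)"
  "coeff3 (ac_curve E) = to_ac (coeff3 E)" "coeff4 (ac_curve E) = to_ac (coeff4 E)"
  "coeff6 (ac_curve E) = to_ac (coeff6 E)"
  by (cases E; simp)+

lemma wpoly_to_ac:
  "wpoly (ac_curve E) (to_ac x) (to_ac y) = to_ac (wpoly E x y)"
  "wpoly_dx (ac_curve E) (to_ac x) (to_ac y) = to_ac (wpoly_dx E x y)"
  "wpoly_dy (ac_curve E) (to_ac x) (to_ac y) = to_ac (wpoly_dy E x y)"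
  by (simp_all add: wpoly_def wpoly_dx_def wpoly_dy_def)

lemma flex_to_ac: "flex (ac_curve E) (to_ac x) (to_ac y) \<longleftrightarrow> flex E x y"
proof -
  have "wpoly_dx (ac_curve E) (to_ac x) (to_ac y) ^ 2 - coeff1 (ac_curve E) *
          wpoly_dx (ac_curve E) (to_ac x) (to_ac y) * wpoly_dy (ac_curve E) (to_ac x) (to_ac y)
       = to_ac (wpoly_dx E x y ^ 2 - coeff1 E * wpoly_dx E x y * wpoly_dy E x y)"
    "(3 * to_ac x + coeff2 (ac_curve E)) * wpoly_dy (ac_curve E) (to_ac x) (to_ac y) ^ 2
       = to_ac ((3 * x + coeff2 E) * wpoly_dy E x y ^ 2)"
    by (simp_all add: wpoly_to_ac)
  then show ?thesis
    unfolding flex_def by (simp only: wpoly_to_ac to_ac_eq_iff to_ac_eq_0_iff)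
qed

text \<open>The standard coefficient formulas for an admissible change of variables with
  \<open>u = 1\<close>.\<close>

definition shift_curve :: "'k::field wcurve \<Rightarrow> 'k \<Rightarrow> 'k \<Rightarrow> 'k \<Rightarrow> 'k wcurve" where
  "shift_curve E r s t = WCurve (coeff1 E + 2 * s)
     (coeff2 E - s * coeff1 E + 3 * r - s^2)
     (coeff3 E + r * coeff1 E + 2 * t)
     (coeff4 E - s * coeff3 E + 2 * r * coeff2 E - (t + r * s) * coeff1 E + 3 * r^2 - 2 * s * t)
     (coeff6 E + r * coeff4 E + r^2 * coeff2 E + r^3 - t * coeff3 E - t^2 - r * t * coeff1 E)"

lemma wpoly_shift:
  "wpoly (shift_curve E r s t) x y = wpoly E (x + r) (y + s * x + t)"
  unfolding wpoly_def shift_curve_def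
  by (simp add: algebra_simps power2_eq_square power3_eq_cube)

lemma wpoly_dx_shift:
  "wpoly_dx (shift_curve E r s t) x y
     = wpoly_dx E (x + r) (y + s * x + t) + s * wpoly_dy E (x + r) (y + s * x + t)"
  unfolding wpoly_dx_def wpoly_dy_def shift_curve_def
  by (simp add: algebra_simps power2_eq_square)

lemma wpoly_dy_shift:
  "wpoly_dy (shift_curve E r s t) x y = wpoly_dy E (x + r) (y + s * x + t)"
  unfolding wpoly_dy_def shift_curve_def by (simp add: algebra_simps)

lemma flex_shift:
  "flex (shift_curve E r s t) x y \<longleftrightarrow> flex E (x + r) (y + s * x + t)"
proof -
  define dx dy where "dx = wpoly_dx E (x + r) (y + s * x + t)"
    and "dy = wpoly_dy E (x + r) (y + s * x + t)"
  have "(dx + s * dy)^2 - (coeff1 E + 2 * s) * (dx + s * dy) * dy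
      - (3 * x + (coeff2 E - s * coeff1 E + 3 * r - s^2)) * dy^2
      = dx^2 - coeff1 E * dx * dy - (3 * (x + r) + coeff2 E) * dy^2"
    by (simp add: algebra_simps power2_eq_square)
  then have "(dx + s * dy)^2 - (coeff1 E + 2 * s) * (dx + s * dy) * dy
      = (3 * x + (coeff2 E - s * coeff1 E + 3 * r - s^2)) * dy^2
      \<longleftrightarrow> dx^2 - coeff1 E * dx * dy = (3 * (x + r) + coeff2 E) * dy^2"
    by (metis eq_iff_diff_eq_0)
  then show ?thesis
    unfolding flex_def wpoly_shift wpoly_dx_shift wpoly_dy_shift
    by (simp add: shift_curve_def dx_def dy_def)
qed

lemma ac_curve_shift:
  "ac_curve (shift_curve E r s t) = shift_curve (ac_curve E) (to_ac r) (to_ac s) (to_ac t)"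
  by (simp add: shift_curve_def)

text \<open>By the chain rule the two partial derivatives change by an invertible matrix, so a
  singular point comes from a singular point.\<close>

lemma elliptic_shift: "elliptic E \<Longrightarrow> elliptic (shift_curve E r s t)"
  unfolding elliptic_def ac_curve_shift wpoly_shift wpoly_dx_shift wpoly_dy_shift by auto

lemma isomorphic_shift: "isomorphic_over_base E (shift_curve E r s t)"
  unfolding isomorphic_over_base_def ac_curve_shift wpoly_shift
  by (rule exI[of _ 1], rule exI[of _ r], rule exI[of _ s], rule exI[of _ t]) simp

lemma shift_to_short:
  assumes "(2::'k::field) \<noteq> 0" "(3::'k) \<noteq> 0"
  obtains r s t A B where "shift_curve (E :: 'k wcurve) r s t = short_curve A B"
proof -
  \<comment> \<open>\<open>s\<close> and \<open>t\<close> complete the square in \<open>y\<close>,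
    removing \<open>coeff1\<close> and \<open>coeff3\<close>; \<open>r\<close> completes the cube in
    \<open>x\<close>, removing \<open>coeff2\<close>.\<close>
  define s where "s = - coeff1 E / 2"
  define r where "r = (s^2 + s * coeff1 E - coeff2 E) / 3"
  define t where "t = - (coeff3 E + r * coeff1 E) / 2"
  have "2 * s = - coeff1 E" "3 * r = s^2 + s * coeff1 E - coeff2 E"
    "2 * t = - (coeff3 E + r * coeff1 E)"
    using assms by (simp_all add: s_def r_def t_def)
  then show ?thesis
    using that[of r s t] by (simp add: shift_curve_def short_curve_def)
qed

text \<open>\<open>flex\<close> is a polynomial condition and descends along the injective map
  \<open>to_ac\<close>, which turns the property into one over the base field alone.\<close>

lemma has_rational_point_of_order_three_iff:
  "has_rational_point_of_order E 3 \<longleftrightarrow> (\<exists>x y. flex E x y)"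
proof -
  have "has_rational_point_of_order E 3 \<longleftrightarrow> (\<exists>x y. flex (ac_curve E) (to_ac x) (to_ac y))"
    unfolding has_rational_point_of_order_def has_order_three_iff
  proof (intro iffI; elim exE conjE)
    fix P x y
    assume "rational_point P" "P = Affine x y" "flex (ac_curve E) x y"
    then show "\<exists>x y. flex (ac_curve E) (to_ac x) (to_ac y)"
      by auto
  next
    fix x y
    assume "flex (ac_curve E) (to_ac x) (to_ac y)"
    then show "\<exists>P. (\<exists>x y. P = Affine x y \<and> flex (ac_curve E) x y) \<and> rational_point P"
      by (intro exI[of _ "Affine (to_ac x) (to_ac y)"]) auto
  qed
  then show ?thesis
    by (simp only: flex_to_ac)
qed

section \<open>Isomorphisms between short equations\<close>

lemma wpoly_short: "wpoly (short_curve A B) x y = y^2 - (x^3 + A * x + B)"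
  by (simp add: wpoly_def short_curve_def)

lemma ac_curve_short: "ac_curve (short_curve A B) = short_curve (to_ac A) (to_ac B)"
  by (simp add: short_curve_def)

lemma isomorphic_short_iff:
  assumes "(2::'a::field) \<noteq> 0" "(3::'a) \<noteq> 0"
  shows "isomorphic_over_base (short_curve A B) (short_curve A' (B' :: 'a)) \<longleftrightarrow>
     (\<exists>u. u \<noteq> 0 \<and> A = u^4 * A' \<and> B = u^6 * B')"
proof
  assume "isomorphic_over_base (short_curve A B) (short_curve A' B')"
  then obtain u r s t :: 'a where u: "u \<noteq> 0" and ac:
    "\<And>x y. wpoly (ac_curve (short_curve A B)) (to_ac u ^ 2 * x + to_ac r)
            (to_ac u ^ 3 * y + to_ac u ^ 2 * to_ac s * x + to_ac t)
          = to_ac u ^ 6 * wpoly (ac_curve (short_curve A' B')) x y"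
    unfolding isomorphic_over_base_def by blast
  have eq: "wpoly (short_curve A B) (u^2 * x + r) (u^3 * y + u^2 * s * x + t)
      = u^6 * wpoly (short_curve A' B') x y" for x y
    using ac[of "to_ac x" "to_ac y"]
    by (simp flip: to_ac_mult to_ac_add to_ac_power add: wpoly_to_ac)
  \<comment> \<open>The terms in \<open>y^2\<close> and \<open>x^3\<close> cancel; these are the
    remaining coefficients in \<open>x\<close>. Evaluation at five points with coordinates in 0, 1
    and -1 shows that they and \<open>r\<close>, \<open>s\<close>, \<open>t\<close> vanish, so only
    the scaling by \<open>u\<close> is left.\<close>
  define c0 c1 c2 where "c0 = B + r * A + r^3 - t^2 - u^6 * B'"
    and "c1 = (A + 3 * r^2 - 2 * s * t) * u^2 - u^6 * A'" and "c2 = (3 * r - s^2) * u^4"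
  have F: "2 * s * u^5 * (x * y) + 2 * t * u^3 * y = c2 * x^2 + c1 * x + c0" for x y
    using eq[of x y] unfolding wpoly_short c0_def c1_def c2_def
    by (simp add: algebra_simps power2_eq_square power3_eq_cube eval_nat_numeral)
  have c0: "c0 = 0" using F[of 0 0] by simp
  then have t: "t = 0" using F[of 0 1] u assms by simp
  have c12: "c2 + c1 = 0" "c2 - c1 = 0"
    using F[of 1 0] F[of "-1" 0] c0 by simp_all
  then have s: "s = 0" using F[of 1 1] c0 t u assms by simp
  have "2 * c2 = 0" using c12 by (simp add: algebra_simps)
  then have "c2 = 0" using assms by simp
  then have "r = 0" "c1 = 0" using c12 s u assms by (simp_all add: c2_def)
  then have "A * u^2 = (u^4 * A') * u^2" "B = u^6 * B'"
    using c0 s t unfolding c0_def c1_def by (simp_all add: eval_nat_numeral mult_ac)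
  then show "\<exists>u. u \<noteq> 0 \<and> A = u^4 * A' \<and> B = u^6 * B'"
    using u by auto
next
  assume "\<exists>u. u \<noteq> 0 \<and> A = u^4 * A' \<and> B = u^6 * B'"
  then obtain u where u: "u \<noteq> 0" "A = u^4 * A'" "B = u^6 * B'" by blast
  show "isomorphic_over_base (short_curve A B) (short_curve A' B')"
    unfolding isomorphic_over_base_def
    by (rule exI[of _ u], rule exI[of _ 0], rule exI[of _ 0], rule exI[of _ 0])
       (use u in \<open>simp add: ac_curve_short wpoly_short algebra_simps eval_nat_numeral\<close>)
qed

section \<open>Short Weierstrass curves\<close>

text \<open>\<open>- three_div A B x\<close> is the value at \<open>x\<close> of the third division polynomial.\<close>

definition three_div :: "'k::field \<Rightarrow> 'k \<Rightarrow> 'k \<Rightarrow> 'k" where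
  "three_div A B x = (3 * x^2 + A)^2 - 12 * x * (x^3 + A * x + B)"

lemma flex_short_iff:
  assumes "(2::'k::field) \<noteq> 0"
  shows "flex (short_curve A B) x (y :: 'k) \<longleftrightarrow>
    y \<noteq> 0 \<and> y^2 = x^3 + A * x + B \<and> three_div A B x = 0"
proof -
  have "flex (short_curve A B) x y \<longleftrightarrow>
     y^2 = x^3 + A * x + B \<and> y \<noteq> 0 \<and> (3 * x^2 + A)^2 = 12 * x * y^2"
    using assms unfolding flex_def wpoly_short
    by (auto simp: wpoly_dx_def wpoly_dy_def short_curve_def power2_eq_square algebra_simps)
  then show ?thesis by (auto simp: three_div_def)
qed

text \<open>In characteristic other than 2 a singular point has \<open>y = 0\<close>, so it amounts
  to a common root of the cubic and its derivative.\<close>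

lemma elliptic_short_iff:
  assumes "(2::'a::field) \<noteq> 0"
  shows "elliptic (short_curve A (B :: 'a)) \<longleftrightarrow>
    (\<forall>x. \<not> (x^3 + to_ac A * x + to_ac B = 0 \<and> 3 * x^2 + to_ac A = 0))"
proof -
  have "(2 :: 'a alg_closure) \<noteq> 0"
    using assms to_ac_eq_0_iff[of "2 :: 'a"] by simp
  then have *: "wpoly_dx (short_curve (to_ac A) (to_ac B)) x y = - (3 * x^2 + to_ac A)"
      "wpoly_dy (short_curve (to_ac A) (to_ac B)) x y = 0 \<longleftrightarrow> y = 0" for x y
    by (simp_all add: wpoly_dx_def wpoly_dy_def short_curve_def)
  show ?thesis
    unfolding elliptic_def ac_curve_short wpoly_short * neg_equal_0_iff_equal
    by (metis diff_0 neg_equal_0_iff_equal zero_power2)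
qed

text \<open>A common root \<open>x\<close> for the twist gives the common root \<open>x / t\<close>
  for the original cubic and its derivative.\<close>

lemma elliptic_quadratic_twist:
  assumes "(2::'a::field) \<noteq> 0" "t \<noteq> 0" "elliptic (short_curve A (B :: 'a))"
  shows "elliptic (quadratic_twist t A B)"
  unfolding quadratic_twist_def elliptic_short_iff[OF assms(1)]
proof (intro allI notI; elim conjE)
  fix x :: "'a alg_closure"
  let ?t = "to_ac t"
  assume x: "x^3 + to_ac (t^2 * A) * x + to_ac (t^3 * B) = 0" "3 * x^2 + to_ac (t^2 * A) = 0"
  define z where "z = x / ?t"
  have z: "x = ?t * z" using assms(2) by (simp add: z_def)
  have "?t^3 * (z^3 + to_ac A * z + to_ac B) = 0" "?t^2 * (3 * z^2 + to_ac A) = 0"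
    using x unfolding z by (simp_all add: algebra_simps power2_eq_square power3_eq_cube)
  then show False
    using assms(2,3) unfolding elliptic_short_iff[OF assms(1)] by simp
qed

lemma three_div_to_ac: "three_div (to_ac A) (to_ac B) (to_ac x) = to_ac (three_div A B x)"
  by (simp add: three_div_def)

section \<open>Finite fields\<close>

text \<open>Multiplication by a nonzero \<open>x\<close> permutes the nonzero elements; comparing
  their products gives exponent \<open>q - 1\<close>.\<close>

lemma power_CARD_eq_self: "(x :: 'a::{field,finite}) ^ CARD('a) = x"
proof (cases "x = 0")
  case False
  let ?U = "UNIV - {0 :: 'a}"
  have "bij_betw ((*) x) ?U ?U"
    by (rule bij_betwI[where g = "\<lambda>y. y / x"]) (use False in auto)
  then have "\<Prod>?U = (\<Prod>y\<in>?U. x * y)"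
    by (rule prod.reindex_bij_betw[symmetric])
  also have "\<dots> = x ^ card ?U * \<Prod>?U"
    by (simp only: prod.distrib prod_constant)
  finally have "x ^ card ?U = 1"
    by simp
  then have "x ^ Suc (card ?U) = x"
    by (simp only: power_Suc mult_1_right)
  then show ?thesis
    by (metis card_Suc_Diff1 finite UNIV_I)
qed simp

text \<open>The polynomial \<open>X^q - X\<close> has at most \<open>q\<close> roots, and the base
  field already supplies \<open>q\<close> of them.\<close>

lemma in_range_to_ac_iff:
  "(z :: 'a::{field,finite} alg_closure) \<in> range to_ac \<longleftrightarrow> z ^ CARD('a) = z"
proof
  assume "z \<in> range to_ac"
  then show "z ^ CARD('a) = z"
    by (auto simp flip: to_ac_power simp: power_CARD_eq_self)
next
  assume z: "z ^ CARD('a) = z"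
  define p :: "'a alg_closure poly" where "p = monom 1 (CARD('a)) - monom 1 1"
  have "card {0, 1 :: 'a} \<le> CARD('a)"
    by (rule card_mono) auto
  then have q: "CARD('a) \<ge> 2"
    by simp
  then have "coeff p (CARD('a)) = 1"
    by (simp add: p_def)
  then have p: "p \<noteq> 0"
    by auto
  have deg: "degree p \<le> CARD('a)"
    unfolding p_def by (intro degree_diff_le degree_monom_le order_trans[OF degree_monom_le])
      (use q in simp)
  have root: "poly p y = 0 \<longleftrightarrow> y ^ CARD('a) = y" for y
    by (simp add: p_def poly_monom)
  have "range to_ac \<subseteq> {y. poly p y = 0}"
    unfolding root by (auto simp flip: to_ac_power simp: power_CARD_eq_self)
  moreover have "card {y. poly p y = 0} \<le> card (range (to_ac :: 'a \<Rightarrow> _))"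
    using card_poly_roots_bound[OF p] deg by (simp add: card_image inj_to_ac)
  ultimately have "range to_ac = {y. poly p y = 0}"
    using poly_roots_finite[OF p] by (intro card_seteq) auto
  then show "z \<in> range to_ac"
    using z root by blast
qed

text \<open>Squaring is two-to-one on nonzero elements, so the nonzero squares \<open>S\<close> are
  half of them. The coset \<open>T = t S\<close> is disjoint from \<open>S\<close> and fills the
  other half; hence \<open>c\<close> is \<open>t\<close> times a square.\<close>

lemma nonsquare_mult_nonsquare:
  assumes two: "(2 :: 'a::{field,finite}) \<noteq> 0"
    and t: "\<nexists>s. t = s^2" and c: "\<nexists>s. (c :: 'a) = s^2"
  obtains s where "t * c = s^2"
proof -
  let ?U = "UNIV - {0 :: 'a}"
  define S where "S = (\<lambda>x. x^2) ` ?U"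
  have fib: "card {x \<in> ?U. x^2 = y} = 2" if "y \<in> S" for y
  proof -
    obtain z where z: "z \<noteq> 0" "y = z^2"
      using \<open>y \<in> S\<close> by (auto simp: S_def)
    have "z \<noteq> - z"
    proof
      assume "z = - z"
      then have "2 * z = 0" by (metis add.right_inverse mult_2)
      then show False using z two by simp
    qed
    moreover have "{x \<in> ?U. x^2 = y} = {z, - z}"
      using z by (auto simp: power2_eq_iff)
    ultimately show ?thesis by simp
  qed
  have "card ?U = (\<Sum>y\<in>S. card {x \<in> ?U. x^2 = y})"
    using sum.image_gen[of ?U "\<lambda>_. 1 :: nat" "\<lambda>x. x^2"] by (simp add: S_def)
  then have card_U: "card ?U = card S + card S"
    using fib by simp
  have t0: "t \<noteq> 0"
    using t by (metis zero_power2)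
  define T where "T = (*) t ` S"
  have "card T = card S"
    unfolding T_def using t0 by (intro card_image) (auto simp: inj_on_def)
  moreover have "S \<inter> T = {}"
  proof (rule ccontr)
    assume "S \<inter> T \<noteq> {}"
    then obtain x y where xy: "y \<noteq> 0" "x^2 = t * y^2"
      by (auto simp: S_def T_def)
    then have "t = (x / y)^2"
      by (simp add: power_divide)
    then show False using t by blast
  qed
  ultimately have "card (S \<union> T) = card ?U"
    using card_U by (simp add: card_Un_disjoint)
  moreover have "S \<union> T \<subseteq> ?U"
    using t0 by (auto simp: S_def T_def)
  ultimately have "S \<union> T = ?U"
    by (intro card_subset_eq) auto
  moreover have "c \<noteq> 0"
    using c by (metis zero_power2)
  ultimately have "c \<in> S \<union> T"
    by auto
  then obtain z where "c = t * z^2"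
    using c by (auto simp: S_def T_def)
  then have "t * c = (t * z)^2"
    by (simp add: power2_eq_square)
  then show ?thesis by (rule that)
qed

lemma two_three_neq_0:
  assumes "CHAR('a::{field,finite}) \<noteq> 2" "CARD('a) mod 3 = 1"
  shows "(2 :: 'a) \<noteq> 0" "(3 :: 'a) \<noteq> 0"
proof -
  show "(2 :: 'a) \<noteq> 0"
  proof
    assume "(2 :: 'a) = 0"
    then have "of_nat 2 = (0 :: 'a)" by simp
    then have "CHAR('a) dvd 2"
      by (simp only: of_nat_eq_0_iff_char_dvd)
    moreover from this have "CHAR('a) \<le> 2"
      by (rule dvd_imp_le) simp
    moreover have "CHAR('a) \<noteq> Suc 0"
      by simp
    ultimately show False
      using assms(1) by (cases "CHAR('a) = 0") auto
  qed
  \<comment> \<open>Translation by 1 permutes the field, so \<open>q = 0\<close> in it. As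
    \<open>q\<close> is 1 modulo 3, the equation \<open>3 = 0\<close> would give
    \<open>1 = 0\<close>.\<close>
  have "(\<Sum>x\<in>UNIV. x + 1) = (\<Sum>x\<in>UNIV. x :: 'a)"
    by (rule sum.reindex_bij_betw) (rule bij_betwI[where g = "\<lambda>x. x - 1"], auto)
  then have "of_nat (CARD('a)) = (0 :: 'a)"
    by (simp add: sum.distrib)
  moreover have "of_nat (CARD('a)) = 3 * of_nat (CARD('a) div 3) + (1 :: 'a)"
    by (metis assms(2) mult_div_mod_eq of_nat_1 of_nat_add of_nat_mult of_nat_numeral)
  ultimately show "(3 :: 'a) \<noteq> 0"
    by auto
qed

section \<open>Rational subgroups of order three\<close>

text \<open>The two nonzero points share their abscissa, so Frobenius stability fixes it and puts it
  in the base field. The irrationality must then sit in the ordinate.\<close>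

lemma flex_of_rational_subgroup:
  assumes ell: "elliptic (E :: 'a::{field,finite} wcurve)" and two: "(2 :: 'a) \<noteq> 0"
    and sub: "has_rational_subgroup_without_rational_points E 3"
  obtains x y where "y \<notin> range to_ac" "flex (ac_curve E) (to_ac x) y"
proof -
  obtain G where G: "subgroup G (ec_group E)" "frobenius_point ` G = G" "card G = 3"
    and nr: "\<And>P. P \<in> G \<Longrightarrow> P \<noteq> Infinity \<Longrightarrow> \<not> rational_point P"
    using sub unfolding has_rational_subgroup_without_rational_points_def rational_subgroup_def
    by blast
  obtain x y where xy: "flex (ac_curve E) x y"
    "G = {Infinity, Affine x y, point_neg (ac_curve E) (Affine x y)}"
    using flex_of_subgroup_of_order_three[OF ell two G(1,3)] by blast
  have "frobenius_point (Affine x y) \<in> G"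
    using G(2) xy(2) by blast
  then have "x ^ CARD('a) = x"
    unfolding xy(2) by (auto simp: frobenius_point_def)
  then obtain x' where x': "x = to_ac x'"
    unfolding in_range_to_ac_iff[symmetric] by blast
  have "Affine x y \<in> G"
    using xy(2) by blast
  then have "\<not> rational_point (Affine x y)"
    by (rule nr) simp
  then have "y \<notin> range to_ac"
    using x' by simp
  then show ?thesis
    using that xy(1) x' by blast
qed

lemma square_root_to_ac:
  assumes "y^2 = to_ac c" "c = s^2"
  shows "y \<in> range to_ac"
proof -
  have "y^2 = (to_ac s)^2"
    using assms by simp
  then have "y = to_ac s \<or> y = to_ac (- s)"
    by (simp add: power2_eq_iff)
  then show ?thesis
    by blast
qed

text \<open>Over a rational root \<open>x\<close> of the division polynomial, the ordinates are the
  square roots of the cubic's value, which are irrational exactly when that value is a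
  nonsquare.\<close>

lemma short_has_rational_subgroup_iff:
  assumes ell: "elliptic (short_curve A (B :: 'a::{field,finite}))" and two: "(2 :: 'a) \<noteq> 0"
  shows "has_rational_subgroup_without_rational_points (short_curve A B) 3 \<longleftrightarrow>
    (\<exists>x. (\<nexists>s. x^3 + A * x + B = s^2) \<and> three_div A B x = 0)"
proof -
  have two': "(2 :: 'a alg_closure) \<noteq> 0"
    using two to_ac_eq_0_iff[of "2 :: 'a"] by simp
  have f: "to_ac x ^ 3 + to_ac A * to_ac x + to_ac B = to_ac (x^3 + A * x + B)" for x
    by simp
  show ?thesis
  proof
    assume "has_rational_subgroup_without_rational_points (short_curve A B) 3"
    then obtain x y where y: "y \<notin> range to_ac"
      and fl: "flex (ac_curve (short_curve A B)) (to_ac x) y"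
      using flex_of_rational_subgroup[OF ell two] by blast
    then have y2: "y^2 = to_ac (x^3 + A * x + B)" and td: "three_div A B x = 0"
      unfolding ac_curve_short flex_short_iff[OF two'] three_div_to_ac f by simp_all
    have "x^3 + A * x + B \<noteq> s^2" for s
      using y y2 square_root_to_ac by metis
    then show "\<exists>x. (\<nexists>s. x^3 + A * x + B = s^2) \<and> three_div A B x = 0"
      using td by blast
  next
    assume "\<exists>x. (\<nexists>s. x^3 + A * x + B = s^2) \<and> three_div A B x = 0"
    then obtain x where ns: "\<And>s. x^3 + A * x + B \<noteq> s^2" and td: "three_div A B x = 0"
      by blast
    obtain y where y2: "y^2 = to_ac (x^3 + A * x + B)"
      using nth_root_exists[of 2 "to_ac (x^3 + A * x + B)"] by auto
    have y: "y \<notin> range to_ac"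
    proof
      assume "y \<in> range to_ac"
      then obtain s where "y = to_ac s" by blast
      then show False
        using y2 ns[of s] by (metis to_ac_eq_iff to_ac_power)
    qed
    then have "y \<noteq> 0"
      by (metis rangeI to_ac_0)
    let ?G = "{Infinity, Affine (to_ac x) y, point_neg (ac_curve (short_curve A B)) (Affine (to_ac x) y)}"
    have G: "?G = {Infinity, Affine (to_ac x) y, Affine (to_ac x) (- y)}"
      by (simp add: short_curve_def)
    have "flex (ac_curve (short_curve A B)) (to_ac x) y"
      unfolding ac_curve_short flex_short_iff[OF two'] three_div_to_ac f
      using y2 td \<open>y \<noteq> 0\<close> by simp
    note sub = subgroup_of_flex[OF this]
    \<comment> \<open>Frobenius sends \<open>y\<close> to a square root of the same rational value,
      hence to \<open>y\<close> or \<open>-y\<close>; so it fixes or swaps the two nonzero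
      points.\<close>
    have "(y ^ CARD('a))^2 = (y^2) ^ CARD('a)"
      by (simp add: mult.commute flip: power_mult)
    also have "\<dots> = y^2"
      unfolding y2 using in_range_to_ac_iff by blast
    finally have "(y ^ CARD('a))^2 = y^2" .
    then have fy: "y ^ CARD('a) = y \<or> y ^ CARD('a) = - y"
      by (simp add: power2_eq_iff)
    have "(- 1 :: 'a alg_closure) ^ CARD('a) = - 1"
      using in_range_to_ac_iff[of "- 1 :: 'a alg_closure"] by (metis rangeI to_ac_1 to_ac_minus)
    then have fny: "(- y) ^ CARD('a) = - (y ^ CARD('a))"
      by (metis mult_minus1 power_mult_distrib)
    have fx: "to_ac x ^ CARD('a) = to_ac x"
      using in_range_to_ac_iff by blast
    have "frobenius_point ` ?G = ?G"
      unfolding G using fx fy fny by (auto simp: frobenius_point_def)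
    moreover have "\<forall>P\<in>?G. P \<noteq> Infinity \<longrightarrow> \<not> rational_point P"
    proof -
      have "- y \<notin> range to_ac"
      proof
        assume "- y \<in> range to_ac"
        then obtain z where "- y = to_ac z" by blast
        then have "y = to_ac (- z)"
          by (metis minus_minus to_ac_minus)
        then show False using y by blast
      qed
      then show ?thesis
        unfolding G using y by auto
    qed
    ultimately show "has_rational_subgroup_without_rational_points (short_curve A B) 3"
      using sub
      unfolding has_rational_subgroup_without_rational_points_def rational_subgroup_def by blast
  qed
qed

lemma short_has_rational_point_iff:
  assumes "(2 :: 'a::field) \<noteq> 0"
  shows "has_rational_point_of_order (short_curve A (B :: 'a)) 3 \<longleftrightarrow>
    (\<exists>x s. s \<noteq> 0 \<and> x^3 + A * x + B = s^2 \<and> three_div A B x = 0)"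
  unfolding has_rational_point_of_order_three_iff flex_short_iff[OF assms] by metis

section \<open>Twisting\<close>

lemma twist_cubic:
  "(t * x)^3 + (t^2 * A) * (t * x) + t^3 * B = t^3 * (x^3 + A * x + (B :: 'a::field))"
  by (simp add: algebra_simps power2_eq_square power3_eq_cube)

text \<open>\<open>three_div\<close> is homogeneous of weight 4 when \<open>x\<close>,
  \<open>A\<close>, \<open>B\<close> have weights 1, 2, 3.\<close>

lemma three_div_twist:
  "three_div (t^2 * A) (t^3 * B) (t * x) = t^4 * three_div A B x"
  unfolding three_div_def twist_cubic by (simp add: algebra_simps eval_nat_numeral)

text \<open>At \<open>t * x\<close> the twisted cubic takes the value
  \<open>t^3 * y^2 = t * (t * y)^2\<close>, a nonsquare because \<open>y\<close> is nonzero.\<close>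

lemma quadratic_twist_of_rational_point:
  assumes two: "(2 :: 'a::{field,finite}) \<noteq> 0" and t: "t \<noteq> 0" "\<nexists>s. t = s^2"
    and ell: "elliptic (short_curve A (B :: 'a))"
    and pt: "has_rational_point_of_order (short_curve A B) 3"
  shows "has_rational_subgroup_without_rational_points (quadratic_twist t A B) 3"
proof -
  obtain x y where xy: "y \<noteq> 0" "x^3 + A * x + B = y^2" "three_div A B x = 0"
    using pt unfolding short_has_rational_point_iff[OF two] by blast
  have "(t * x)^3 + (t^2 * A) * (t * x) + t^3 * B \<noteq> s^2" for s
  proof
    assume "(t * x)^3 + (t^2 * A) * (t * x) + t^3 * B = s^2"
    then have "t * (t * y)^2 = s^2"
      unfolding twist_cubic xy(2) by (simp add: power2_eq_square power3_eq_cube mult_ac)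
    then have "t = (s / (t * y))^2"
      using t(1) xy(1) unfolding power_divide by (metis mult_eq_0_iff nonzero_eq_divide_eq power_eq_0_iff)
    then show False using t(2) by blast
  qed
  moreover have "three_div (t^2 * A) (t^3 * B) (t * x) = 0"
    using xy(3) by (simp add: three_div_twist)
  ultimately show ?thesis
    using elliptic_quadratic_twist[OF two t(1) ell]
    unfolding quadratic_twist_def by (subst short_has_rational_subgroup_iff[OF _ two]) blast+
qed

text \<open>The value of the cubic at \<open>x\<close> is a nonsquare, so \<open>t\<close> times it
  is a square \<open>s^2\<close>, and the twisted cubic takes the value \<open>(t * s)^2\<close> at
  \<open>t * x\<close>.\<close>

lemma quadratic_twist_of_rational_subgroup:
  assumes two: "(2 :: 'a::{field,finite}) \<noteq> 0" and t: "t \<noteq> 0" "\<nexists>s. t = s^2"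
    and ell: "elliptic (short_curve A (B :: 'a))"
    and sub: "has_rational_subgroup_without_rational_points (short_curve A B) 3"
  shows "has_rational_point_of_order (quadratic_twist t A B) 3"
proof -
  obtain x where x: "\<nexists>s. x^3 + A * x + B = s^2" "three_div A B x = 0"
    using sub unfolding short_has_rational_subgroup_iff[OF ell two] by blast
  obtain s where s: "t * (x^3 + A * x + B) = s^2"
    using nonsquare_mult_nonsquare[OF two t(2) x(1)] by blast
  have "x^3 + A * x + B \<noteq> 0"
    using x(1) by (metis zero_power2)
  then have "t * s \<noteq> 0"
    using s t(1) by auto
  moreover have "(t * x)^3 + (t^2 * A) * (t * x) + t^3 * B = (t * s)^2"
  proof -
    have "(t * x)^3 + (t^2 * A) * (t * x) + t^3 * B = t^2 * (t * (x^3 + A * x + B))"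
      unfolding twist_cubic by (simp add: power2_eq_square power3_eq_cube)
    then show ?thesis
      by (simp only: s power_mult_distrib)
  qed
  moreover have "three_div (t^2 * A) (t^3 * B) (t * x) = 0"
    using x(2) by (simp add: three_div_twist)
  ultimately show ?thesis
    unfolding quadratic_twist_def short_has_rational_point_iff[OF two] by blast
qed

text \<open>The factors \<open>t^2\<close> and \<open>t^3\<close> cancel from the scaling
  conditions, so the same \<open>u\<close> serves on both sides.\<close>

lemma isomorphic_quadratic_twist_iff:
  assumes "(2 :: 'a::field) \<noteq> 0" "(3 :: 'a) \<noteq> 0" "t \<noteq> 0"
  shows "isomorphic_over_base (quadratic_twist t A B) (quadratic_twist t A' (B' :: 'a))
    \<longleftrightarrow> isomorphic_over_base (short_curve A B) (short_curve A' B')"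
proof -
  have "t^2 * A = u^4 * (t^2 * A') \<longleftrightarrow> A = u^4 * A'" "t^3 * B = u^6 * (t^3 * B') \<longleftrightarrow> B = u^6 * B'" for u
    using assms(3) mult_cancel_left[of "t^2" A "u^4 * A'"] mult_cancel_left[of "t^3" B "u^6 * B'"]
    by (simp_all add: mult_ac)
  then show ?thesis
    unfolding quadratic_twist_def isomorphic_short_iff[OF assms(1,2)] by simp
qed

text \<open>The double twist has coefficients \<open>t^4 * A\<close> and \<open>t^6 * B\<close>,
  which is the scaling with \<open>u = t\<close>.\<close>

lemma quadratic_twist_twice:
  assumes "(2 :: 'a::field) \<noteq> 0" "(3 :: 'a) \<noteq> 0" "t \<noteq> 0"
  shows "isomorphic_over_base (quadratic_twist t (t^2 * A) (t^3 * B)) (short_curve A (B :: 'a))"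
  unfolding quadratic_twist_def isomorphic_short_iff[OF assms(1,2)]
  by (rule exI[of _ t]) (use assms(3) in \<open>simp flip: mult.assoc power_add\<close>)

section \<open>Isomorphism classes and their short representatives\<close>

lemma ec_iso_class_eq_iff:
  assumes "elliptic E" "elliptic E'"
  shows "ec_iso `` {E} = ec_iso `` {E'} \<longleftrightarrow> isomorphic_over_base E E'"
  using eq_equiv_class_iff[OF equiv_ec_iso, of E E'] assms by (simp add: ec_iso_def)

text \<open>\<open>twist_class\<close> is a union over all short equations in the class; their
  twists are isomorphic to each other, so the union collapses to one class.\<close>

lemma twist_class_short:
  assumes nz: "(2 :: 'a::field) \<noteq> 0" "(3 :: 'a) \<noteq> 0" "t \<noteq> 0"
    and ell: "elliptic (short_curve A (B :: 'a))"
  shows "twist_class t (ec_iso `` {short_curve A B}) = ec_iso `` {quadratic_twist t A B}"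
proof -
  let ?T = "{quadratic_twist t A' B' | A' B'. short_curve A' B' \<in> ec_iso `` {short_curve A B}}"
  have same: "ec_iso `` {E} = ec_iso `` {quadratic_twist t A B}" if E: "E \<in> ?T" for E
  proof -
    obtain A' B' where E': "E = quadratic_twist t A' B'" "elliptic (short_curve A' B')"
      "isomorphic_over_base (short_curve A B) (short_curve A' B')"
      using E by (auto simp: ec_iso_def)
    then have "isomorphic_over_base (quadratic_twist t A' B') (quadratic_twist t A B)"
      by (simp add: isomorphic_over_base_sym isomorphic_quadratic_twist_iff[OF nz])
    then show ?thesis
      using E' ell nz by (simp add: ec_iso_class_eq_iff elliptic_quadratic_twist)
  qed
  have "short_curve A B \<in> ec_iso `` {short_curve A B}"
    using ell by (simp add: ec_iso_def isomorphic_over_base_refl)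
  then have "?T \<noteq> {}" by blast
  have "twist_class t (ec_iso `` {short_curve A B}) = (\<Union>E\<in>?T. ec_iso `` {E})"
    unfolding twist_class_def by (rule Image_eq_UN)
  also have "\<dots> = ec_iso `` {quadratic_twist t A B}"
    by (rule SUP_eq_const[OF \<open>?T \<noteq> {}\<close> same])
  finally show ?thesis .
qed

text \<open>Stated for a general property \<open>P\<close> to serve both sides of the
  correspondence; \<open>shift\<close> transports \<open>P\<close> to the short equation.\<close>

lemma quotient_short_representative:
  assumes nz: "(2 :: 'a::field) \<noteq> 0" "(3 :: 'a) \<noteq> 0"
    and shift: "\<And>(E :: 'a wcurve) r s t A B. elliptic E \<Longrightarrow> P E \<Longrightarrow>
      shift_curve E r s t = short_curve A B \<Longrightarrow> P (short_curve A B)"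
    and C: "C \<in> {E. elliptic E \<and> P E} // ec_iso"
  obtains A B where "elliptic (short_curve A B)" "P (short_curve A B)"
    "C = ec_iso `` {short_curve A B}"
proof -
  obtain E where E: "elliptic E" "P E" "C = ec_iso `` {E}"
    using C by (auto elim: quotientE)
  obtain r s t A B where S: "shift_curve E r s t = short_curve A B"
    using shift_to_short[OF nz] by blast
  have "elliptic (short_curve A B)" "P (short_curve A B)"
    using elliptic_shift[OF E(1), of r s t] shift[OF E(1,2) S] by (simp_all add: S)
  moreover have "C = ec_iso `` {short_curve A B}"
    using E(3) isomorphic_shift[of E r s t] calculation(1) E(1) unfolding S
    by (simp add: ec_iso_class_eq_iff)
  ultimately show ?thesis by (rule that)
qed

lemma rational_point_shift:
  assumes "has_rational_point_of_order E 3"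
  shows "has_rational_point_of_order (shift_curve E r s t) 3"
proof -
  obtain x y where "flex E x y"
    using assms unfolding has_rational_point_of_order_three_iff by blast
  then have "flex (shift_curve E r s t) (x - r) (y - s * (x - r) - t)"
    by (simp add: flex_shift)
  then show ?thesis
    unfolding has_rational_point_of_order_three_iff by blast
qed

text \<open>Only one generator is moved: its abscissa stays rational and its ordinate changes by a
  rational amount, so it stays irrational. The criterion for short equations then supplies the
  subgroup.\<close>

lemma rational_subgroup_shift_to_short:
  assumes two: "(2 :: 'a::{field,finite}) \<noteq> 0" and ell: "elliptic (E :: 'a wcurve)"
    and S: "shift_curve E r s t = short_curve A B"
    and sub: "has_rational_subgroup_without_rational_points E 3"
  shows "has_rational_subgroup_without_rational_points (short_curve A B) 3"
proof -
  have two': "(2 :: 'a alg_closure) \<noteq> 0"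
    using two to_ac_eq_0_iff[of "2 :: 'a"] by simp
  obtain x y where y: "y \<notin> range to_ac" and fl: "flex (ac_curve E) (to_ac x) y"
    using flex_of_rational_subgroup[OF ell two sub] by blast
  define y' where "y' = y - to_ac (s * (x - r) + t)"
  have yy': "y = y' + to_ac (s * (x - r) + t)"
    by (simp add: y'_def)
  have y': "y' \<notin> range to_ac"
  proof
    assume "y' \<in> range to_ac"
    then obtain z where "y' = to_ac z" by blast
    then have "y = to_ac (z + (s * (x - r) + t))"
      unfolding yy' by (simp only: to_ac_add)
    then show False using y by blast
  qed
  have "flex (ac_curve (shift_curve E r s t)) (to_ac (x - r)) y'"
    unfolding ac_curve_shift flex_shift using fl by (simp add: yy' add.assoc)
  then have "y'^2 = to_ac ((x - r)^3 + A * (x - r) + B)" and td: "three_div A B (x - r) = 0"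
    unfolding S ac_curve_short flex_short_iff[OF two'] three_div_to_ac by simp_all
  moreover from this have "(x - r)^3 + A * (x - r) + B \<noteq> z^2" for z
    using square_root_to_ac y' by metis
  ultimately show ?thesis
    using elliptic_shift[OF ell, of r s t] unfolding S
    by (subst short_has_rational_subgroup_iff[OF _ two]) blast+
qed

theorem mainTheorem2:
  fixes t :: "'a::{field,finite}"
  assumes char: "CHAR('a) \<noteq> 2"
    and q: "CARD('a) mod 3 = 1"
    and t: "t \<noteq> 0" "\<nexists>s. t = s^2"
  shows "bij_betw (twist_class t)
    ({E. elliptic E \<and> has_rational_point_of_order E 3} // ec_iso)
    ({E. elliptic E \<and> has_rational_subgroup_without_rational_points E 3} // ec_iso)"
proof -
  note nz = two_three_neq_0[OF char q]
  note twist_class = twist_class_short[OF nz t(1)]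
  note ell_twist = elliptic_quadratic_twist[OF nz(1) t(1)]
  let ?Pt = "{E :: 'a wcurve. elliptic E \<and> has_rational_point_of_order E 3} // ec_iso"
  let ?Sub = "{E :: 'a wcurve. elliptic E \<and>
      has_rational_subgroup_without_rational_points E 3} // ec_iso"
  have Pt: "\<exists>A B. elliptic (short_curve A B) \<and> has_rational_point_of_order (short_curve A B) 3
      \<and> C = ec_iso `` {short_curve A B}" if "C \<in> ?Pt" for C
    using quotient_short_representative[OF nz _ that] rational_point_shift by metis
  have Sub: "\<exists>A B. elliptic (short_curve A B)
      \<and> has_rational_subgroup_without_rational_points (short_curve A B) 3
      \<and> C = ec_iso `` {short_curve A B}" if "C \<in> ?Sub" for C
    using quotient_short_representative[OF nz _ that] rational_subgroup_shift_to_short[OF nz(1)]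
    by metis
  have "inj_on (twist_class t) ?Pt"
  proof (rule inj_onI)
    fix C D
    assume "C \<in> ?Pt" "D \<in> ?Pt" and eq: "twist_class t C = twist_class t D"
    then obtain A B A' B' where C: "elliptic (short_curve A B)" "C = ec_iso `` {short_curve A B}"
      and D: "elliptic (short_curve A' B')" "D = ec_iso `` {short_curve A' B'}"
      using Pt by metis
    have "ec_iso `` {quadratic_twist t A B} = ec_iso `` {quadratic_twist t A' B'}"
      using eq C D by (simp add: twist_class)
    \<comment> \<open>Isomorphic twists come from isomorphic curves.\<close>
    then show "C = D"
      using C D ell_twist
      by (simp add: ec_iso_class_eq_iff isomorphic_quadratic_twist_iff[OF nz t(1)])
  qed
  moreover have "twist_class t C \<in> ?Sub" if inPt: "C \<in> ?Pt" for C
  proof -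
    obtain A B where C: "elliptic (short_curve A B)"
      "has_rational_point_of_order (short_curve A B) 3" "C = ec_iso `` {short_curve A B}"
      using Pt[OF inPt] by blast
    then show ?thesis
      using ell_twist quadratic_twist_of_rational_point[OF nz(1) t]
      by (auto simp: twist_class intro!: quotientI)
  qed
  moreover have "C \<in> twist_class t ` ?Pt" if inSub: "C \<in> ?Sub" for C
  proof -
    obtain A B where C: "elliptic (short_curve A B)"
      "has_rational_subgroup_without_rational_points (short_curve A B) 3"
      "C = ec_iso `` {short_curve A B}"
      using Sub[OF inSub] by blast
    let ?T = "quadratic_twist t A B"
    have T: "elliptic ?T" "has_rational_point_of_order ?T 3"
      using ell_twist C quadratic_twist_of_rational_subgroup[OF nz(1) t] by auto
    \<comment> \<open>The class of the twist is the preimage: it has a short representative again,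
      and twisting that once more returns to \<open>C\<close>.\<close>
    have "twist_class t (ec_iso `` {?T}) = ec_iso `` {quadratic_twist t (t^2 * A) (t^3 * B)}"
      using T(1) unfolding quadratic_twist_def[of t A B] by (rule twist_class)
    also have "\<dots> = C"
      using C(1,3) T(1) ell_twist[of "t^2 * A" "t^3 * B"] quadratic_twist_twice[OF nz t(1)]
      by (simp add: ec_iso_class_eq_iff quadratic_twist_def[of t A B])
    finally have "C = twist_class t (ec_iso `` {?T})" ..
    moreover have "ec_iso `` {?T} \<in> ?Pt"
      using T by (auto intro: quotientI)
    ultimately show ?thesis
      by (rule image_eqI)
  qed
  ultimately show ?thesis
    unfolding bij_betw_def by blast
qed

end
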